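(* Let $q$ be a prime power and $Q=q^2$. Let $T=\left\{\begin{pmatrix}1&x\\0&1\end{pmatrix} : x\in\mathbb F_{Q}\right\}\le\mathrm{SL}(2,Q)$, $\Omega=\{g\in\mathrm{SL}(2,Q) : (0,1)\,g\,(1,0)^{\mathsf T}\in\mathbb F_q\}$, $\Omega^{\mathsf c}=\mathrm{SL}(2,Q)\smallsetminus\Omega$, and $A=\{Tg : g\in\Omega\}\cup\{gT : g\in\Omega^{\mathsf c}\}$. For $h\in\mathrm{SL}(2,Q)$ let $\vartheta_h(x)=h^{-1}x\overline h$, where $\overline{\,\cdot\,}$ is the automorphism $y\mapsto y^q$ of $\mathbb F_Q$ applied entrywise, let $\vartheta_h$ act on cosets elementwise and put $A\cdot\vartheta_h=\{\vartheta_h(X) : X\in A\}$. Then $\pi_{\mathsf{sq}}=\{A\cdot\vartheta_h : h\in\mathrm{SL}(2,Q)\}$ is a parallelism on $\mathfrak S$, i.e. a partition of the set $\mathfrak S$ of all right cosets of Sylow $p$-subgroups of $\mathrm{SL}(2,Q)$ into $Q+1$ sets, each consisting of $Q^2-1$ pairwise disjoint cosets.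
   Context: $p$ is the characteristic of $\mathbb F_q$. $\mathfrak S=\{Pg : P \text{ a Sylow } p\text{-subgroup of } \mathrm{SL}(2,Q),\ g\in\mathrm{SL}(2,Q)\}$. *)

theory Defs
  imports
    "HOL-Analysis.Analysis"
    "HOL-Algebra.Algebra"
    "HOL-Algebra.Algebraic_Closure_Type"
    "HOL-Number_Theory.Prime_Powers"
    "HOL-Library.Disjoint_Sets"
begin

definition SL2 :: "('a::field ^ 2 ^ 2) monoid" where
  "SL2 = \<lparr>carrier = {g. det g = 1}, monoid.mult = (**), one = mat 1\<rparr>"

definition sylow_subgroup :: "nat \<Rightarrow> ('g, 'm) monoid_scheme \<Rightarrow> 'g set \<Rightarrow> bool" where
  "sylow_subgroup p G P \<longleftrightarrow> subgroup P G \<and> card P = p ^ multiplicity p (order G)"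

definition sylow_right_cosets :: "nat \<Rightarrow> ('g, 'm) monoid_scheme \<Rightarrow> 'g set set" where
  "sylow_right_cosets p G =
     {P #>\<^bsub>G\<^esub> g | P g. sylow_subgroup p G P \<and> g \<in> carrier G}"

definition T_grp :: "('a::field ^ 2 ^ 2) set" where
  "T_grp = {vector [vector [1, x], vector [0, 1]] | x. True}"

text \<open>The scalar \<open>(0,1) g (1,0)\<^sup>T\<close> is the lower left entry of \<open>g\<close>
  (\<open>g $ i $ j\<close> is the entry in row \<open>i\<close> and column \<open>j\<close>).\<close>

definition Omega :: "'a::field set \<Rightarrow> ('a ^ 2 ^ 2) set" where
  "Omega Fq = {g \<in> carrier SL2. g $ 2 $ 1 \<in> Fq}"

definition A_sq :: "'a::field set \<Rightarrow> ('a ^ 2 ^ 2) set set" where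
  "A_sq Fq = {T_grp #>\<^bsub>SL2\<^esub> g | g. g \<in> Omega Fq}
           \<union> {g <#\<^bsub>SL2\<^esub> T_grp | g. g \<in> carrier SL2 - Omega Fq}"

definition mat_bar :: "nat \<Rightarrow> 'a::field ^ 2 ^ 2 \<Rightarrow> 'a ^ 2 ^ 2" where
  "mat_bar q g = (\<chi> i j. (g $ i $ j) ^ q)"

definition theta :: "nat \<Rightarrow> 'a::field ^ 2 ^ 2 \<Rightarrow> 'a ^ 2 ^ 2 \<Rightarrow> 'a ^ 2 ^ 2" where
  "theta q h x = (inv\<^bsub>SL2\<^esub> h \<otimes>\<^bsub>SL2\<^esub> x) \<otimes>\<^bsub>SL2\<^esub> mat_bar q h"

definition pi_sq :: "nat \<Rightarrow> 'a::field set \<Rightarrow> ('a ^ 2 ^ 2) set set set" where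
  "pi_sq q Fq = {(`) (theta q h) ` A_sq Fq | h. h \<in> carrier SL2}"

end

theory Submission
  imports Defs "HOL-Number_Theory.Residues"
begin

text \<open>
  Write \<open>C(u,v) = {x. det x = 1 \<and> x u = v}\<close> for nonzero column vectors. A \<open>p\<close>-subgroup permutes the
  \<open>Q\<^sup>2 - 1\<close> nonzero vectors and so fixes one of them; hence the Sylow subgroups are the \<open>C(v,v)\<close>,
  their cosets are the \<open>C(u,v)\<close>, and \<open>C(u,v)\<close> determines \<open>(u,v)\<close> up to a common scalar. The image of \<open>A\<close>
  under \<open>\<vartheta>\<close> of \<open>h\<close> depends only on the line of \<open>w\<close>, the inverse of \<open>h\<close> applied to \<open>(1,0)\<close>, and
  consists of the \<open>C(u,w)\<close> with \<open>det(w*,u)\<close> in \<open>Fq\<close> and the \<open>C(w*,v)\<close> with \<open>det(w,v)\<close> not in \<open>Fq\<close>, where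
  \<open>w*\<close> is the conjugate of \<open>w\<close>. So \<open>C(u,v)\<close> can only lie in the parts of the lines of \<open>v\<close> and of
  the conjugate of \<open>u\<close>, and the conditions for these two are complementary.
\<close>

no_notation fps_nth (infixl \<open>$\<close> 75)

section \<open>Determinants and adjugates in dimension two\<close>

text \<open>Lines are compared through this form: on nonzero vectors it vanishes exactly when they
  are proportional.\<close>

definition det2 :: "'a::field ^ 2 \<Rightarrow> 'a ^ 2 \<Rightarrow> 'a" where
  "det2 u v = u $ 1 * v $ 2 - u $ 2 * v $ 1"

text \<open>The set C(u,v) of the overview.\<close>

definition transporter :: "'a::field ^ 2 \<Rightarrow> 'a ^ 2 \<Rightarrow> ('a ^ 2 ^ 2) set" where
  "transporter u v = {x. det x = 1 \<and> x *v u = v}"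

text \<open>The adjugate serves as an explicit inverse on determinant 1, so that identities can be
  checked entrywise.\<close>

definition adj2 :: "'a::field ^ 2 ^ 2 \<Rightarrow> 'a ^ 2 ^ 2" where
  "adj2 h = vector [vector [h $ 2 $ 2, - h $ 1 $ 2], vector [- h $ 2 $ 1, h $ 1 $ 1]]"

abbreviation e1 :: "'a::field ^ 2" where
  "e1 \<equiv> vector [1, 0]"

lemmas mat2_simps = vec_eq_iff forall_2 sum_2 matrix_vector_mult_def matrix_matrix_mult_def
  det_2 mat_def adj2_def det2_def

lemma det2_mult_vec: "det2 (A *v u) (A *v v) = det A * det2 u v"
  by (simp add: mat2_simps algebra_simps)

lemma det2_scale [simp]: "det2 (c *s u) v = c * det2 u v" "det2 u (c *s v) = c * det2 u v"
  by (simp_all add: mat2_simps algebra_simps)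

lemma det2_self [simp]: "det2 u u = 0"
  by (simp add: det2_def)

lemma det2_eq_0_trans:
  assumes "u \<noteq> 0" "det2 u v = 0" "det2 u w = 0"
  shows "det2 v w = 0"
proof (cases "u $ 1 = 0")
  case True
  with assms show ?thesis by (auto simp: mat2_simps)
next
  case False
  \<comment> \<open>First coordinate of the linear relation between three vectors of the plane
    (Cramer's rule).\<close>
  have "u $ 1 * det2 v w = v $ 1 * det2 u w - w $ 1 * det2 u v"
    by (simp add: mat2_simps algebra_simps)
  with assms False show ?thesis by simp
qed

lemma det2_sym_eq_0: "det2 u v = 0 \<longleftrightarrow> det2 v u = 0"
  by (auto simp: det2_def algebra_simps)

lemma det2_eq_0_imp_multiple:
  assumes "u \<noteq> 0" "v \<noteq> 0" "det2 u v = 0"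
  obtains c where "c \<noteq> 0" "v = c *s u"
proof (cases "u $ 1 = 0")
  case True
  with assms have "v = (v $ 2 / u $ 2) *s u" "v $ 2 / u $ 2 \<noteq> 0"
    by (auto simp: mat2_simps field_simps)
  then show ?thesis using that by blast
next
  case False
  with assms have "v = (v $ 1 / u $ 1) *s u" "v $ 1 / u $ 1 \<noteq> 0"
    by (auto simp: mat2_simps field_simps)
  then show ?thesis using that by blast
qed

lemma adj2_inverse:
  assumes "det h = 1"
  shows "h ** adj2 h = mat 1" "adj2 h ** h = mat 1" "det (adj2 h) = 1"
  using assms by (simp_all add: mat2_simps algebra_simps)

lemma adj2_cancel:
  assumes "det h = 1"
  shows "h *v (adj2 h *v v) = v" "adj2 h *v (h *v v) = v"
    "h ** (adj2 h ** A) = A" "adj2 h ** (h ** A) = A"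
  by (simp_all add: matrix_vector_mul_assoc matrix_mul_assoc adj2_inverse[OF assms])

lemma mult_vec_eq_0_iff:
  fixes h :: "'a::field ^ 2 ^ 2"
  assumes "det h = 1"
  shows "h *v v = 0 \<longleftrightarrow> v = 0"
  by (metis adj2_cancel(2)[OF assms] matrix_vector_mult_0_right)

section \<open>The group SL(2) and its transporters\<close>

lemma SL2_simps [simp]:
  "carrier SL2 = {g. det g = 1}" "x \<otimes>\<^bsub>SL2\<^esub> y = x ** y" "\<one>\<^bsub>SL2\<^esub> = mat 1"
  by (simp_all add: SL2_def)

lemma group_SL2: "group (SL2 :: ('a::field ^ 2 ^ 2) monoid)"
proof (rule groupI)
  fix x :: "'a ^ 2 ^ 2"
  assume "x \<in> carrier SL2"
  then show "\<exists>y\<in>carrier SL2. y \<otimes>\<^bsub>SL2\<^esub> x = \<one>\<^bsub>SL2\<^esub>"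
    by (intro bexI[of _ "adj2 x"]) (auto simp: adj2_inverse)
qed (auto simp: det_mul matrix_mul_assoc)

lemma inv_SL2: "det h = 1 \<Longrightarrow> inv\<^bsub>SL2\<^esub> h = adj2 h"
  by (rule group.inv_equality[OF group_SL2]) (auto simp: adj2_inverse)

text \<open>Any nonzero w can be completed, as first column, to a matrix of determinant 1. Going
  from u back to \<open>e1\<close> and on to v then gives transitivity.\<close>

lemma transporter_nonempty:
  assumes "u \<noteq> 0" "v \<noteq> (0 :: 'a::field ^ 2)"
  shows "transporter u v \<noteq> {}"
proof -
  have *: "\<exists>g. det g = 1 \<and> g *v e1 = w" if "w \<noteq> 0" for w :: "'a ^ 2"
  proof (cases "w $ 1 = 0")
    case True
    with that show ?thesis
      by (intro exI[of _ "vector [vector [w $ 1, - 1 / w $ 2], vector [w $ 2, 0]]"])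
        (auto simp: mat2_simps)
  next
    case False
    then show ?thesis
      by (intro exI[of _ "vector [vector [w $ 1, 0], vector [w $ 2, 1 / w $ 1]]"])
        (auto simp: mat2_simps)
  qed
  obtain g k where "det g = 1" "g *v e1 = v" and k: "det k = 1" "k *v e1 = u"
    using *[OF assms(1)] *[OF assms(2)] by blast
  moreover have "adj2 k *v u = e1"
    using k adj2_cancel(2) by metis
  ultimately have "g ** adj2 k \<in> transporter u v"
    by (auto simp: transporter_def det_mul adj2_inverse simp flip: matrix_vector_mul_assoc)
  then show ?thesis by blast
qed

text \<open>Moving u to v by \<open>g\<close> and then v to w composes; conversely, divide by
  \<open>g\<close> on the right. For w = v this turns cosets of a stabilizer into
  transporters.\<close>

lemma transporter_r_coset:
  assumes "g \<in> transporter u v"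
  shows "transporter v w #>\<^bsub>SL2\<^esub> g = transporter u w"
proof
  show "transporter v w #>\<^bsub>SL2\<^esub> g \<subseteq> transporter u w"
    using assms by (auto simp: r_coset_def transporter_def det_mul simp flip: matrix_vector_mul_assoc)
  show "transporter u w \<subseteq> transporter v w #>\<^bsub>SL2\<^esub> g"
  proof
    fix x assume x: "x \<in> transporter u w"
    have g: "det g = 1" "adj2 g *v v = u"
      using assms adj2_cancel(2) by (auto simp: transporter_def)
    have "x ** adj2 g \<in> transporter v w"
      using x g by (auto simp: transporter_def det_mul adj2_inverse simp flip: matrix_vector_mul_assoc)
    moreover have "x = (x ** adj2 g) ** g"
      using g by (simp add: adj2_inverse flip: matrix_mul_assoc)
    ultimately show "x \<in> transporter v w #>\<^bsub>SL2\<^esub> g"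
      by (auto simp: r_coset_def)
  qed
qed

lemma transporter_l_coset:
  assumes "g \<in> transporter u v"
  shows "g <#\<^bsub>SL2\<^esub> transporter w u = transporter w v"
proof
  show "g <#\<^bsub>SL2\<^esub> transporter w u \<subseteq> transporter w v"
    using assms by (auto simp: l_coset_def transporter_def det_mul simp flip: matrix_vector_mul_assoc)
  show "transporter w v \<subseteq> g <#\<^bsub>SL2\<^esub> transporter w u"
  proof
    fix x assume x: "x \<in> transporter w v"
    have g: "det g = 1" "adj2 g *v v = u"
      using assms adj2_cancel(2) by (auto simp: transporter_def)
    have "adj2 g ** x \<in> transporter w u"
      using x g by (auto simp: transporter_def det_mul adj2_inverse simp flip: matrix_vector_mul_assoc)
    moreover have "x = g ** (adj2 g ** x)"
      using g by (simp add: adj2_cancel)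
    ultimately show "x \<in> g <#\<^bsub>SL2\<^esub> transporter w u"
      by (auto simp: l_coset_def)
  qed
qed

lemma T_grp_eq_transporter: "T_grp = transporter e1 e1"
proof
  show "transporter e1 e1 \<subseteq> (T_grp :: ('a ^ 2 ^ 2) set)"
  proof
    fix x :: "'a ^ 2 ^ 2" assume "x \<in> transporter e1 e1"
    then have "x = vector [vector [1, x $ 1 $ 2], vector [0, 1]]"
      by (auto simp: transporter_def mat2_simps)
    then show "x \<in> T_grp" unfolding T_grp_def by blast
  qed
qed (auto simp: T_grp_def transporter_def mat2_simps)

lemma transporter_scale:
  assumes "c \<noteq> 0"
  shows "transporter (c *s u) (c *s v) = transporter u v"
  using assms by (auto simp: transporter_def vector_scalar_commute)

lemma transporter_eqD:
  assumes "transporter u v = transporter u' v'" "u \<noteq> 0" "v \<noteq> 0" "u' \<noteq> 0"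
  obtains c where "c \<noteq> 0" "u' = c *s u" "v' = c *s v"
proof -
  obtain x where x: "x \<in> transporter u v" using transporter_nonempty assms by blast
  \<comment> \<open>the transvection \<open>w \<mapsto> w + det(u, w) u\<close>, which fixes exactly the multiples of \<open>u\<close>\<close>
  define s :: "'a ^ 2 ^ 2" where
    "s = vector [vector [1 - u $ 1 * u $ 2, u $ 1 * u $ 1],
                 vector [- u $ 2 * u $ 2, 1 + u $ 1 * u $ 2]]"
  have s: "s *v w = w + det2 u w *s u" "det s = 1" for w
    by (simp_all add: s_def mat2_simps algebra_simps)
  have "x ** s \<in> transporter u v"
    using x by (auto simp: transporter_def det_mul s simp flip: matrix_vector_mul_assoc)
  then have "x ** s \<in> transporter u' v'" "x \<in> transporter u' v'"
    using assms(1) x by auto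
  \<comment> \<open>Both \<open>x ** s\<close> and \<open>x\<close> send u' to v'. Cancelling leaves
    only the contribution of the transvection, a multiple of v, which must vanish.\<close>
  then have "x *v (u' + det2 u u' *s u) = x *v u'"
    by (auto simp: transporter_def s simp flip: matrix_vector_mul_assoc)
  then have "det2 u u' *s v = 0"
    using x by (simp add: transporter_def matrix_vector_right_distrib vector_scalar_commute)
  then have "det2 u u' = 0" using assms by simp
  then obtain c where c: "c \<noteq> 0" "u' = c *s u"
    using det2_eq_0_imp_multiple assms by blast
  moreover have "v' = c *s v"
    using x \<open>x \<in> transporter u' v'\<close> c by (simp add: transporter_def vector_scalar_commute)
  ultimately show ?thesis using that by blast
qed

text \<open>Multiplying by \<open>k\<close> on the left and \<open>g\<close> on the right maps
  \<open>T_grp\<close> bijectively onto the transporter, and \<open>T_grp\<close> is parametrised by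
  the field.\<close>

lemma card_transporter:
  assumes "u \<noteq> 0" "v \<noteq> (0 :: 'a::{field,finite} ^ 2)"
  shows "card (transporter u v) = CARD('a)"
proof -
  have e: "(e1 :: 'a ^ 2) \<noteq> 0" by (simp add: mat2_simps)
  obtain g k where g: "g \<in> transporter u e1" and k: "k \<in> transporter e1 v"
    using transporter_nonempty e assms by blast
  have "transporter u v = (k <#\<^bsub>SL2\<^esub> T_grp) #>\<^bsub>SL2\<^esub> g"
    unfolding T_grp_eq_transporter transporter_l_coset[OF k] transporter_r_coset[OF g] ..
  also have "\<dots> = (\<lambda>x. (k ** x) ** g) ` T_grp"
    by (auto simp: r_coset_def l_coset_def)
  finally have "transporter u v = (\<lambda>x. (k ** x) ** g) ` T_grp" .
  moreover have "inj (\<lambda>x. (k ** x) ** g)"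
  proof (rule inj_on_inverseI)
    fix x :: "'a ^ 2 ^ 2"
    show "adj2 k ** ((k ** x) ** g) ** adj2 g = x"
      using g k by (simp add: transporter_def adj2_cancel adj2_inverse flip: matrix_mul_assoc)
  qed
  ultimately have "card (transporter u v) = card (T_grp :: ('a ^ 2 ^ 2) set)"
    by (simp add: card_image inj_on_subset)
  also have "T_grp = range (\<lambda>x :: 'a. vector [vector [1, x], vector [0, 1]] :: 'a ^ 2 ^ 2)"
    by (auto simp: T_grp_def)
  also have "card \<dots> = CARD('a)"
    by (intro card_image injI) (auto simp: mat2_simps)
  finally show ?thesis .
qed

section \<open>Sylow subgroups of SL(2) and their cosets\<close>

lemma card_vec2_nonzero: "card (UNIV - {0 :: 'a::{field,finite} ^ 2}) = CARD('a) ^ 2 - 1"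
  by (simp add: card_Diff_singleton CARD_vec)

text \<open>Sort the elements by the image of \<open>e1\<close>, which can be any nonzero
  vector.\<close>

lemma order_SL2:
  "order (SL2 :: ('a::{field,finite} ^ 2 ^ 2) monoid) = CARD('a) * (CARD('a) ^ 2 - 1)"
proof -
  have e: "(e1 :: 'a ^ 2) \<noteq> 0" by (simp add: mat2_simps)
  have "(carrier SL2 :: ('a ^ 2 ^ 2) set) = (\<Union>v\<in>UNIV - {0}. transporter e1 v)"
    using e by (auto simp: transporter_def mult_vec_eq_0_iff)
  then have "order (SL2 :: ('a ^ 2 ^ 2) monoid) = card (\<Union>v\<in>UNIV - {0}. transporter (e1 :: 'a ^ 2) v)"
    by (simp add: order_def)
  also have "\<dots> = (\<Sum>v\<in>UNIV - {0}. card (transporter (e1 :: 'a ^ 2) v))"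
    by (intro card_UN_disjoint) (auto simp: transporter_def)
  also have "\<dots> = CARD('a) * (CARD('a) ^ 2 - 1)"
    using e by (simp add: card_transporter card_vec2_nonzero)
  finally show ?thesis .
qed

lemma subgroup_transporter: "subgroup (transporter v v) SL2"
proof (rule group.subgroupI[OF group_SL2])
  show "transporter v v \<noteq> {}"
    by (auto simp: transporter_def intro!: exI[of _ "mat 1"])
  fix a assume "a \<in> transporter v v"
  then show "inv\<^bsub>SL2\<^esub> a \<in> transporter v v"
    using adj2_cancel(2)[of a v] by (auto simp: transporter_def inv_SL2 adj2_inverse)
qed (auto simp: transporter_def det_mul simp flip: matrix_vector_mul_assoc)

text \<open>With m the field size, this makes the number of nonzero vectors prime to p; the same
  number is the index of a vector stabilizer.\<close>

lemma prime_not_dvd_square_minus_1: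
  fixes p m :: nat
  assumes "Factorial_Ring.prime p" "p dvd m" "m > 0"
  shows "\<not> p dvd m ^ 2 - 1"
proof
  assume "p dvd m ^ 2 - 1"
  moreover have "p dvd m ^ 2" using assms by (simp add: power2_eq_square)
  moreover have "m ^ 2 - 1 + 1 = m ^ 2" using assms by simp
  ultimately have "p dvd 1" by (metis dvd_add_right_iff)
  then show False using assms by auto
qed

text \<open>Orbits on nonzero vectors have p-power length, but their lengths sum to a number prime
  to p. So some orbit has length 1.\<close>

lemma p_subgroup_fixes_vector:
  fixes P :: "('a::{field,finite} ^ 2 ^ 2) set"
  assumes P: "subgroup P SL2" and "Factorial_Ring.prime p" "card P = p ^ k" and dvd: "p dvd CARD('a)"
  obtains v where "v \<noteq> 0" "P \<subseteq> transporter v v"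
proof -
  define G :: "('a ^ 2 ^ 2) monoid" where "G = SL2\<lparr>carrier := P\<rparr>"
  define E :: "('a ^ 2) set" where "E = UNIV - {0}"
  \<comment> \<open>Restricted to \<open>E\<close> because elements of \<open>Bij E\<close> must be
    extensional.\<close>
  define \<phi> :: "'a ^ 2 ^ 2 \<Rightarrow> 'a ^ 2 \<Rightarrow> 'a ^ 2" where "\<phi> g = (\<lambda>v\<in>E. g *v v)" for g
  have P1: "det g = 1" if "g \<in> P" for g
    using subgroup.subset[OF P] that by auto
  interpret G: group G
    unfolding G_def using subgroup.subgroup_is_group[OF P group_SL2] .
  have bij: "\<phi> g \<in> Bij E" if "g \<in> P" for g
    unfolding Bij_def
  proof (intro IntI CollectI)
    show "\<phi> g \<in> extensional E" by (simp add: \<phi>_def)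
    show "bij_betw (\<phi> g) E E"
      using P1[OF that]
      by (intro bij_betw_byWitness[of _ "\<lambda>v. adj2 g *v v"])
        (auto simp: \<phi>_def E_def adj2_cancel mult_vec_eq_0_iff adj2_inverse)
  qed
  interpret group_action G E \<phi>
  proof (intro group_action.intro group_hom.intro group_hom_axioms.intro homI)
    show "group G" ..
    show "group (BijGroup E)" by (rule group_BijGroup)
    show "\<phi> g \<in> carrier (BijGroup E)" if "g \<in> carrier G" for g
      using bij that by (simp add: G_def BijGroup_def)
    show "\<phi> (g \<otimes>\<^bsub>G\<^esub> h) = \<phi> g \<otimes>\<^bsub>BijGroup E\<^esub> \<phi> h"
      if gh: "g \<in> carrier G" "h \<in> carrier G" for g h
    proof -
      have "\<phi> (g ** h) = compose E (\<phi> g) (\<phi> h)"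
        using gh mult_vec_eq_0_iff[OF P1, of h]
        by (intro ext) (simp add: G_def \<phi>_def compose_def E_def matrix_vector_mul_assoc)
      then show ?thesis using gh bij by (simp add: G_def BijGroup_def)
    qed
  qed
  have "\<exists>orb\<in>orbits G E \<phi>. \<not> p dvd card orb"
  proof (rule ccontr)
    assume "\<not> ?thesis"
    then have "p dvd (\<Sum>orb\<in>orbits G E \<phi>. \<Sum>x\<in>orb. 1 :: nat)"
      by (auto intro: dvd_sum)
    also have "\<dots> = CARD('a) ^ 2 - 1"
      by (subst disjoint_sum) (simp_all add: E_def card_vec2_nonzero)
    finally show False
      using prime_not_dvd_square_minus_1[OF assms(2) dvd] by simp
  qed
  then obtain v where v: "v \<in> E" "\<not> p dvd card (orbit G \<phi> v)"
    by (auto simp: orbits_def)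
  have "card (orbit G \<phi> v) * card (stabilizer G \<phi> v) = p ^ k"
    using orbit_stabilizer_theorem[OF v(1)] assms(3) by (simp add: order_def G_def)
  then have "card (orbit G \<phi> v) dvd p ^ k"
    by (metis dvd_triv_left)
  then obtain i where "card (orbit G \<phi> v) = p ^ i"
    using divides_primepow_nat[OF \<open>Factorial_Ring.prime p\<close>] by blast
  with v(2) have "card (orbit G \<phi> v) = 1"
    by (cases i) auto
  then obtain w where w: "orbit G \<phi> v = {w}"
    by (rule card_1_singletonE)
  moreover have "v \<in> orbit G \<phi> v" using orbit_refl v(1) by blast
  ultimately have "\<phi> g v = v" if "g \<in> P" for g
    using that by (auto simp: orbit_def G_def)
  then have "P \<subseteq> transporter v v"
    using v(1) P1 by (auto simp: transporter_def \<phi>_def)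
  then show ?thesis using that v(1) by (auto simp: E_def)
qed

text \<open>A vector stabilizer has as many elements as the field, which is the full p-part of the
  group order. A Sylow subgroup lies in a stabilizer by its fixed vector, and equal cardinality
  gives equality.\<close>

lemma sylow_subgroup_SL2_iff:
  fixes P :: "('a::{field,finite} ^ 2 ^ 2) set"
  assumes "Factorial_Ring.prime p" "CARD('a) = p ^ k" "k > 0"
  shows "sylow_subgroup p SL2 P \<longleftrightarrow> (\<exists>v. v \<noteq> 0 \<and> P = transporter v v)"
proof -
  have "\<not> p dvd CARD('a) ^ 2 - 1"
    using prime_gt_0_nat[OF assms(1)] assms by (intro prime_not_dvd_square_minus_1) auto
  then have "multiplicity p (order (SL2 :: ('a ^ 2 ^ 2) monoid)) = k"
    unfolding order_SL2 using assms by (intro multiplicity_eqI) auto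
  then have mult: "p ^ multiplicity p (order (SL2 :: ('a ^ 2 ^ 2) monoid)) = CARD('a)"
    using assms by simp
  show ?thesis
  proof
    assume P: "sylow_subgroup p SL2 P"
    then obtain v where v: "v \<noteq> 0" "P \<subseteq> transporter v v"
      using p_subgroup_fixes_vector[of P p k] assms by (auto simp: sylow_subgroup_def mult)
    moreover have "card P = card (transporter v v)"
      using P v by (simp add: sylow_subgroup_def mult card_transporter)
    ultimately show "\<exists>v. v \<noteq> 0 \<and> P = transporter v v"
      by (metis card_subset_eq finite)
  qed (auto simp: sylow_subgroup_def mult card_transporter subgroup_transporter)
qed

lemma sylow_right_cosets_SL2:
  assumes "Factorial_Ring.prime p" "CARD('a::{field,finite}) = p ^ k" "k > 0"
  shows "sylow_right_cosets p (SL2 :: ('a ^ 2 ^ 2) monoid) =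
    {transporter u v | u v. u \<noteq> 0 \<and> v \<noteq> 0}" (is "?L = ?R")
proof
  show "?L \<subseteq> ?R"
  proof
    fix K assume "K \<in> ?L"
    then obtain v and g :: "'a ^ 2 ^ 2" where g: "v \<noteq> 0" "det g = 1" "K = transporter v v #>\<^bsub>SL2\<^esub> g"
      by (auto simp: sylow_right_cosets_def sylow_subgroup_SL2_iff[OF assms])
    \<comment> \<open>The coset of the stabilizer of v by \<open>g\<close> consists of the maps from
      the preimage of v under \<open>g\<close> to v.\<close>
    then have "g \<in> transporter (adj2 g *v v) v"
      by (simp add: transporter_def adj2_cancel)
    then show "K \<in> ?R"
      using g transporter_r_coset[of g "adj2 g *v v" v v] mult_vec_eq_0_iff[of "adj2 g" v] adj2_inverse[of g]
      by blast
  qed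
  show "?R \<subseteq> ?L"
  proof
    fix K :: "('a ^ 2 ^ 2) set" assume "K \<in> ?R"
    then obtain u v where K: "K = transporter u v" "u \<noteq> 0" "v \<noteq> 0" by blast
    then obtain g where g: "g \<in> transporter u v" using transporter_nonempty by blast
    then have "K = transporter v v #>\<^bsub>SL2\<^esub> g" "det g = 1"
      using K by (auto simp: transporter_r_coset, auto simp: transporter_def)
    then show "K \<in> ?L"
      using K by (auto simp: sylow_right_cosets_def sylow_subgroup_SL2_iff[OF assms])
  qed
qed

section \<open>The subfield as the fixed set of a power map\<close>

text \<open>Fermat's argument: multiplication by a nonzero x permutes the nonzero elements of S, so
  comparing their products gives a power of x equal to 1. It is applied both to \<open>Fq\<close>
  and to the whole field.\<close>

lemma mult_closed_power_card:
  fixes S :: "'a::field set"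
  assumes "finite S" "0 \<in> S" "\<And>x y. x \<in> S \<Longrightarrow> y \<in> S \<Longrightarrow> x * y \<in> S" "x \<in> S"
  shows "x ^ card S = x"
proof (cases "x = 0")
  case True
  with assms show ?thesis by (auto simp: card_gt_0_iff)
next
  case False
  have inj: "inj_on ((*) x) (S - {0})"
    using False by (auto simp: inj_on_def)
  then have "(*) x ` (S - {0}) = S - {0}"
    using assms False by (intro endo_inj_surj) auto
  then have "\<Prod>(S - {0}) = (\<Prod>y\<in>S - {0}. x * y)"
    using prod.reindex[OF inj, of "\<lambda>y. y"] by (simp add: o_def)
  also have "\<dots> = x ^ (card S - 1) * \<Prod>(S - {0})"
    using assms by (simp add: prod.distrib)
  finally have "x ^ (card S - 1) = 1"
    using assms by simp
  moreover have "card S = Suc (card S - 1)"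
    using assms by (metis Suc_pred' card_gt_0_iff empty_iff)
  ultimately show ?thesis by (metis mult.right_neutral power_Suc)
qed

text \<open>The polynomial X^n - X has at most n roots, and S already supplies n of them.\<close>

lemma subset_fixed_points_eq:
  fixes S :: "'a::field set"
  assumes "\<And>x. x \<in> S \<Longrightarrow> x ^ n = x" "card S = n" "n > 1"
  shows "S = {x. x ^ n = x}"
proof -
  define p :: "'a poly" where "p = Polynomial.monom 1 n - Polynomial.monom 1 1"
  have "poly.coeff p n = 1" using assms by (simp add: p_def)
  then have "p \<noteq> 0" by auto
  have "Polynomial.degree p \<le> n"
    unfolding p_def using assms by (intro degree_diff_le) (auto intro: order.trans[OF Polynomial.degree_monom_le])
  moreover have roots: "{x. poly p x = 0} = {x. x ^ n = x}"
    by (simp add: p_def poly_monom)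
  ultimately have "card {x :: 'a. x ^ n = x} \<le> card S"
    using card_poly_roots_bound[OF \<open>p \<noteq> 0\<close>] assms by simp
  moreover have "finite {x :: 'a. x ^ n = x}"
    using poly_roots_finite[OF \<open>p \<noteq> 0\<close>] roots by simp
  ultimately show ?thesis
    using assms by (intro card_seteq) auto
qed

section \<open>Conjugation, the maps theta and the images of A\<close>

text \<open>Isolates what the argument takes from the quadratic extension: conjugation is an
  additive involution given by a power, with fixed set \<open>Fq\<close>.\<close>

locale involutive_power =
  fixes q :: nat and Fq :: "'a::field set"
  assumes power_q_add: "\<And>x y :: 'a. (x + y) ^ q = x ^ q + y ^ q"
    and power_q_power_q [simp]: "\<And>x :: 'a. (x ^ q) ^ q = x"
    and Fq: "Fq = {x. x ^ q = x}"
begin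

lemma q_pos: "q > 0"
proof (rule ccontr)
  assume "\<not> q > 0"
  \<comment> \<open>For q = 0 even the power of 0 is 1, so the map is no involution.\<close>
  then show False using power_q_power_q[of 0] by simp
qed

lemma power_q_minus [simp]: "(- x :: 'a) ^ q = - (x ^ q)"
proof -
  have "x ^ q + (- x) ^ q = (x + - x) ^ q" by (simp only: power_q_add)
  also have "\<dots> = 0" using q_pos by simp
  finally show ?thesis by (simp only: minus_unique)
qed

lemma power_q_diff: "(x - y :: 'a) ^ q = x ^ q - y ^ q"
  using power_q_add[of x "- y"] by simp

lemma power_q_inj: "x ^ q = y ^ q \<longleftrightarrow> x = (y :: 'a)"
  using power_q_power_q by metis

lemma Fq_uminus_iff: "- x \<in> Fq \<longleftrightarrow> x \<in> Fq"
  by (auto simp: Fq)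

lemma Fq_power_iff: "x ^ q \<in> Fq \<longleftrightarrow> x \<in> Fq"
  unfolding Fq using power_q_inj[of "x ^ q" x] by auto

text \<open>The factor \<open>c ^ q * c\<close> is the norm of c, a nonzero element of
  \<open>Fq\<close>. Hence the condition on \<open>det2 (bar v) u\<close> survives scaling u and v
  by a common c.\<close>

lemma Fq_norm_mult_iff: "c \<noteq> 0 \<Longrightarrow> c ^ q * c * x \<in> Fq \<longleftrightarrow> x \<in> Fq"
  by (auto simp: Fq power_mult_distrib)

definition bar :: "'a ^ 2 \<Rightarrow> 'a ^ 2" where
  "bar v = (\<chi> i. (v $ i) ^ q)"

lemma bar_bar [simp]: "bar (bar v) = v"
  by (simp add: bar_def vec_eq_iff)

lemma bar_eq_0_iff [simp]: "bar v = 0 \<longleftrightarrow> v = 0"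
  using q_pos by (simp add: bar_def vec_eq_iff)

lemma bar_e1 [simp]: "bar e1 = e1"
  using q_pos by (simp add: bar_def mat2_simps)

lemma bar_scale [simp]: "bar (c *s v) = c ^ q *s bar v"
  by (simp add: bar_def vec_eq_iff power_mult_distrib)

lemma bar_mult_vec: "bar (h *v v) = mat_bar q h *v bar v"
  by (simp add: bar_def mat_bar_def mat2_simps power_q_add power_mult_distrib)

lemma det2_bar: "det2 (bar u) (bar v) = det2 u v ^ q"
  by (simp add: bar_def det2_def power_q_diff power_mult_distrib)

lemma det_mat_bar: "det (mat_bar q h) = det h ^ q" for h :: "'a ^ 2 ^ 2"
  by (simp add: mat_bar_def det_2 power_q_diff power_mult_distrib)

text \<open>Exchanging the vectors conjugates and negates the value, and \<open>Fq\<close> is stable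
  under both operations.\<close>

lemma det2_bar_swap_in_Fq: "det2 (bar u) v \<in> Fq \<longleftrightarrow> det2 (bar v) u \<in> Fq"
proof -
  have "det2 (bar u) v = - (det2 (bar v) u ^ q)"
    unfolding det2_bar[symmetric] by (simp add: det2_def)
  then show ?thesis by (simp add: Fq_uminus_iff Fq_power_iff)
qed

text \<open>Since theta sends x to the product of the inverse of h, x and the conjugate of h, the
  image maps u to v exactly when x maps \<open>mat_bar q h *v u\<close> to
  \<open>h *v v\<close>.\<close>

lemma theta_transporter:
  fixes h :: "'a ^ 2 ^ 2"
  assumes "det h = 1"
  shows "theta q h ` transporter (mat_bar q h *v u) (h *v v) = transporter u v"
proof -
  have h': "det (mat_bar q h) = 1" using assms by (simp add: det_mat_bar)
  show ?thesis
  proof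
    show "theta q h ` transporter (mat_bar q h *v u) (h *v v) \<subseteq> transporter u v"
      using assms h' by (auto simp: transporter_def theta_def inv_SL2 det_mul adj2_inverse adj2_cancel
          simp flip: matrix_vector_mul_assoc)
    show "transporter u v \<subseteq> theta q h ` transporter (mat_bar q h *v u) (h *v v)"
    proof
      fix y assume "y \<in> transporter u v"
      then have "h ** y ** adj2 (mat_bar q h) \<in> transporter (mat_bar q h *v u) (h *v v)"
        using assms h' by (auto simp: transporter_def det_mul adj2_inverse adj2_cancel
          simp flip: matrix_vector_mul_assoc)
      moreover have "y = theta q h (h ** y ** adj2 (mat_bar q h))"
        using assms h' by (simp add: theta_def inv_SL2 adj2_inverse adj2_cancel flip: matrix_mul_assoc)
      ultimately show "y \<in> theta q h ` transporter (mat_bar q h *v u) (h *v v)" by blast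
    qed
  qed
qed

lemma inj_theta: "det h = 1 \<Longrightarrow> inj (theta q h)" for h :: "'a ^ 2 ^ 2"
  by (rule inj_on_inverseI[of _ "\<lambda>y. h ** y ** adj2 (mat_bar q h)"])
    (simp add: theta_def inv_SL2 adj2_inverse adj2_cancel det_mat_bar flip: matrix_mul_assoc)

text \<open>\<open>part (h\<^sup>-\<^sup>1 *v e1)\<close> is the image of \<open>A\<close> under \<open>\<vartheta>\<close> of \<open>h\<close>.\<close>

definition part :: "'a ^ 2 \<Rightarrow> ('a ^ 2 ^ 2) set set" where
  "part w = {transporter u w | u. u \<noteq> 0 \<and> det2 (bar w) u \<in> Fq}
          \<union> {transporter (bar w) v | v. det2 w v \<notin> Fq}"

lemma zero_in_Fq [simp]: "0 \<in> Fq"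
  using q_pos by (simp add: Fq)

text \<open>A coset Tg is C(u,\<open>e1\<close>) with \<open>u = adj2 g *v e1\<close>, whose second
  coordinate is minus the lower left entry of g; gT is C(\<open>e1\<close>,v) with
  \<open>v = g *v e1\<close>, whose second coordinate is that entry. Finally
  \<open>det2 e1 u\<close> is \<open>u $ 2\<close>.\<close>

lemma A_sq_eq_part: "A_sq Fq = part e1"
proof -
  have 1: "{T_grp #>\<^bsub>SL2\<^esub> g | g. g \<in> Omega Fq} = {transporter u e1 | u. u \<noteq> 0 \<and> u $ 2 \<in> Fq}"
    (is "?L = ?R")
  proof
    show "?L \<subseteq> ?R"
    proof
      fix K assume "K \<in> ?L"
      then obtain g where g: "K = transporter e1 e1 #>\<^bsub>SL2\<^esub> g" "det g = 1" "g $ 2 $ 1 \<in> Fq"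
        by (auto simp: Omega_def T_grp_eq_transporter)
      then have "K = transporter (adj2 g *v e1) e1"
        using transporter_r_coset[of g "adj2 g *v e1" e1 e1] by (simp add: transporter_def adj2_cancel)
      moreover have "(adj2 g *v e1) $ 2 = - g $ 2 $ 1"
        by (simp add: mat2_simps)
      moreover have "adj2 g *v e1 \<noteq> 0"
        using g by (simp add: mult_vec_eq_0_iff adj2_inverse) (simp add: mat2_simps)
      ultimately show "K \<in> ?R" using g Fq_uminus_iff by auto
    qed
    show "?R \<subseteq> ?L"
    proof
      fix K assume "K \<in> ?R"
      then obtain u where u: "K = transporter u e1" "u \<noteq> 0" "u $ 2 \<in> Fq" by blast
      moreover have "e1 \<noteq> (0 :: 'a ^ 2)" by (simp add: mat2_simps)
      ultimately obtain g where g: "g \<in> transporter u e1"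
        using transporter_nonempty by blast
      then have "K = T_grp #>\<^bsub>SL2\<^esub> g" "det g = 1" "adj2 g *v e1 = u"
        using u adj2_cancel(2)[of g u]
        by (auto simp: T_grp_eq_transporter transporter_r_coset) (auto simp: transporter_def)
      moreover have "(adj2 g *v e1) $ 2 = - g $ 2 $ 1"
        by (simp add: mat2_simps)
      ultimately show "K \<in> ?L"
        using u Fq_uminus_iff by (auto simp: Omega_def)
    qed
  qed
  have 2: "{g <#\<^bsub>SL2\<^esub> T_grp | g. g \<in> carrier SL2 - Omega Fq} = {transporter e1 v | v. v $ 2 \<notin> Fq}"
    (is "?L = ?R")
  proof
    have *: "(g *v e1) $ 2 = g $ 2 $ 1" for g :: "'a ^ 2 ^ 2"
      by (simp add: mat2_simps)
    show "?L \<subseteq> ?R"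
    proof
      fix K assume "K \<in> ?L"
      then obtain g where g: "K = g <#\<^bsub>SL2\<^esub> transporter e1 e1" "det g = 1" "g $ 2 $ 1 \<notin> Fq"
        by (auto simp: Omega_def T_grp_eq_transporter)
      then have "K = transporter e1 (g *v e1)"
        using transporter_l_coset[of g e1 "g *v e1" e1] by (simp add: transporter_def)
      with g * show "K \<in> ?R" by auto
    qed
    show "?R \<subseteq> ?L"
    proof
      fix K assume "K \<in> ?R"
      then obtain v where v: "K = transporter e1 v" "v $ 2 \<notin> Fq" by blast
      moreover have "e1 \<noteq> (0 :: 'a ^ 2)" by (simp add: mat2_simps)
      moreover have "v \<noteq> 0" using v by auto
      ultimately obtain g where g: "g \<in> transporter e1 v"
        using transporter_nonempty by blast
      then have "K = g <#\<^bsub>SL2\<^esub> T_grp" "det g = 1" "g *v e1 = v"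
        using v by (auto simp: T_grp_eq_transporter transporter_l_coset) (auto simp: transporter_def)
      with * v show "K \<in> ?L"
        by (auto simp: Omega_def)
    qed
  qed
  show ?thesis
    unfolding A_sq_def part_def 1 2 bar_e1 by (simp add: det2_def)
qed

text \<open>Substitute \<open>mat_bar q h *v u\<close> and \<open>h *v v\<close> for the free
  vectors: conjugation is compatible with h, and both matrices have determinant 1, so the conditions
  on \<open>det2\<close> are unchanged.\<close>

lemma theta_part:
  assumes "det h = 1"
  shows "(`) (theta q h) ` part (h *v w) = part w"
proof -
  have h': "det (mat_bar q h) = 1" using assms by (simp add: det_mat_bar)
  have s: "surj ((*v) h)" "surj ((*v) (mat_bar q h))"
    using adj2_cancel(1)[OF assms] adj2_cancel(1)[OF h'] by (metis surjI)+
  have 1: "{transporter u (h *v w) | u. u \<noteq> 0 \<and> det2 (bar (h *v w)) u \<in> Fq}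
    = (\<lambda>u. transporter (mat_bar q h *v u) (h *v w)) ` {u. u \<noteq> 0 \<and> det2 (bar w) u \<in> Fq}"
    (is "?L = ?R")
  proof
    show "?L \<subseteq> ?R"
    proof
      fix K assume "K \<in> ?L"
      then obtain u where u: "K = transporter u (h *v w)" "u \<noteq> 0" "det2 (bar (h *v w)) u \<in> Fq" by blast
      obtain u' where "u = mat_bar q h *v u'" using s(2) by (metis surjD)
      with u h' show "K \<in> ?R"
        by (auto simp: bar_mult_vec det2_mult_vec mult_vec_eq_0_iff)
    qed
  qed (use h' in \<open>auto simp: bar_mult_vec det2_mult_vec mult_vec_eq_0_iff\<close>)
  have 2: "{transporter (bar (h *v w)) v | v. det2 (h *v w) v \<notin> Fq}
    = (\<lambda>v. transporter (mat_bar q h *v bar w) (h *v v)) ` {v. det2 w v \<notin> Fq}"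
    (is "?L = ?R")
  proof
    show "?L \<subseteq> ?R"
    proof
      fix K assume "K \<in> ?L"
      then obtain v where v: "K = transporter (bar (h *v w)) v" "det2 (h *v w) v \<notin> Fq" by blast
      obtain v' where "v = h *v v'" using s(1) by (metis surjD)
      with v assms show "K \<in> ?R"
        by (auto simp: bar_mult_vec det2_mult_vec)
    qed
  qed (use assms in \<open>auto simp: bar_mult_vec det2_mult_vec\<close>)
  show ?thesis
    unfolding part_def 1 2 image_Un image_image theta_transporter[OF assms]
    by blast
qed

text \<open>By transitivity, the vectors \<open>adj2 h *v e1\<close> run through all nonzero
  vectors.\<close>

lemma pi_sq_eq_parts: "pi_sq q Fq = part ` (UNIV - {0})"
proof
  show "pi_sq q Fq \<subseteq> part ` (UNIV - {0})"
  proof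
    fix B assume "B \<in> pi_sq q Fq"
    then obtain h where h: "det h = 1" "B = (`) (theta q h) ` part e1"
      by (auto simp: pi_sq_def A_sq_eq_part)
    then have "B = part (adj2 h *v e1)"
      using theta_part[OF h(1), of "adj2 h *v e1"] by (simp add: adj2_cancel)
    moreover have "adj2 h *v e1 \<noteq> 0"
      using h by (simp add: mult_vec_eq_0_iff adj2_inverse) (simp add: mat2_simps)
    ultimately show "B \<in> part ` (UNIV - {0})" by blast
  qed
  show "part ` (UNIV - {0}) \<subseteq> pi_sq q Fq"
  proof
    fix B assume "B \<in> part ` (UNIV - {0})"
    then obtain w where w: "B = part w" "w \<noteq> 0" by blast
    moreover have "e1 \<noteq> (0 :: 'a ^ 2)" by (simp add: mat2_simps)
    ultimately obtain h where "h \<in> transporter w e1"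
      using transporter_nonempty by blast
    then have "det h = 1" "B = (`) (theta q h) ` A_sq Fq"
      using theta_part[of h w] w by (auto simp: A_sq_eq_part transporter_def)
    then show "B \<in> pi_sq q Fq" by (auto simp: pi_sq_def)
  qed
qed

section \<open>Which cosets lie in which part\<close>

lemma part_subset: "w \<noteq> 0 \<Longrightarrow> part w \<subseteq> {transporter u v | u v. u \<noteq> 0 \<and> v \<noteq> 0}"
proof -
  assume "w \<noteq> 0"
  moreover have "v \<noteq> 0" if "det2 w v \<notin> Fq" for v
    using that zero_in_Fq by (auto simp: det2_def)
  ultimately show ?thesis
    unfolding part_def using bar_eq_0_iff by blast
qed

text \<open>Each coset picks out exactly one line \<open>w\<close>: the two ways of lying in \<open>part w\<close> are complementary,
  since \<open>det2 (bar u) v\<close> is minus the conjugate of \<open>det2 (bar v) u\<close>.\<close>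

lemma transporter_in_part_iff:
  assumes "u \<noteq> 0" "v \<noteq> 0" "w \<noteq> 0"
  shows "transporter u v \<in> part w \<longleftrightarrow>
    (if det2 (bar v) u \<in> Fq then det2 v w = 0 else det2 (bar u) w = 0)"
proof
  assume "transporter u v \<in> part w"
  then consider (a) u' where "transporter u v = transporter u' w" "u' \<noteq> 0" "det2 (bar w) u' \<in> Fq"
    | (b) v' where "transporter u v = transporter (bar w) v'" "det2 w v' \<notin> Fq"
    by (auto simp: part_def)
  then show "if det2 (bar v) u \<in> Fq then det2 v w = 0 else det2 (bar u) w = 0"
  proof cases
    case a
    then obtain c where c: "c \<noteq> 0" "u' = c *s u" "w = c *s v"
      using transporter_eqD assms by metis
    \<comment> \<open>The common scalar c enters the condition only through its norm.\<close>
    then show ?thesis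
      using a(3) Fq_norm_mult_iff[OF c(1), of "det2 (bar v) u"] by (simp add: mult_ac)
  next
    case b
    have "bar w \<noteq> 0" using assms by simp
    then obtain c where c: "c \<noteq> 0" "bar w = c *s u" "v' = c *s v"
      using transporter_eqD[OF b(1)] assms by metis
    have w: "w = c ^ q *s bar u"
      using c(2) by (metis bar_bar bar_scale)
    then have "det2 (bar u) v \<notin> Fq"
      using b(2) c Fq_norm_mult_iff[OF c(1), of "det2 (bar u) v"] by (simp add: mult_ac)
    then have "det2 (bar v) u \<notin> Fq" by (simp add: det2_bar_swap_in_Fq)
    with w show ?thesis by simp
  qed
next
  assume *: "if det2 (bar v) u \<in> Fq then det2 v w = 0 else det2 (bar u) w = 0"
  show "transporter u v \<in> part w"
  proof (cases "det2 (bar v) u \<in> Fq")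
    case True
    with * assms obtain c where c: "c \<noteq> 0" "w = c *s v"
      using det2_eq_0_imp_multiple by (metis (full_types))
    \<comment> \<open>Rescale the pair so that its second vector becomes w itself.\<close>
    have "transporter u v = transporter (c *s u) w"
      using c by (simp add: transporter_scale)
    moreover have "c *s u \<noteq> 0" using c assms by simp
    moreover have "det2 (bar w) (c *s u) \<in> Fq"
      using c True Fq_norm_mult_iff[OF c(1), of "det2 (bar v) u"] by (simp add: mult_ac)
    ultimately show ?thesis unfolding part_def by blast
  next
    case False
    have "bar u \<noteq> 0" using assms by simp
    with * assms False obtain c where c: "c \<noteq> 0" "w = c *s bar u"
      using det2_eq_0_imp_multiple by (metis (full_types))
    have c': "c ^ q \<noteq> 0" using c by simp
    \<comment> \<open>Scaling by \<open>c ^ q\<close> turns u into \<open>bar w\<close>, since w is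
      c times \<open>bar u\<close>.\<close>
    have "transporter u v = transporter (bar w) (c ^ q *s v)"
      using c c' by (simp add: transporter_scale)
    moreover have "det2 w (c ^ q *s v) \<notin> Fq"
      using c False Fq_norm_mult_iff[OF c(1), of "det2 (bar u) v"] det2_bar_swap_in_Fq[of u v]
      by (simp add: mult_ac)
    ultimately show ?thesis unfolding part_def by blast
  qed
qed

text \<open>The membership criterion sees only the line of w.\<close>

lemma part_cong:
  assumes "w \<noteq> 0" "w' \<noteq> 0" "det2 w w' = 0"
  shows "part w = part w'"
proof -
  have iff: "det2 x w = 0 \<longleftrightarrow> det2 x w' = 0" for x
    using assms det2_eq_0_trans det2_sym_eq_0 by metis
  have "transporter u v \<in> part w \<longleftrightarrow> transporter u v \<in> part w'" if "u \<noteq> 0" "v \<noteq> 0" for u v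
    using that assms by (simp add: transporter_in_part_iff iff)
  then show ?thesis using part_subset assms by blast
qed

lemma parts_meet_imp:
  assumes "w \<noteq> 0" "w' \<noteq> 0" "K \<in> part w" "K \<in> part w'"
  shows "det2 w w' = 0"
proof -
  obtain u v where uv: "K = transporter u v" "u \<noteq> 0" "v \<noteq> 0"
    using assms part_subset by blast
  \<comment> \<open>The vector spanning the line that the coset selects.\<close>
  define x where "x = (if det2 (bar v) u \<in> Fq then v else bar u)"
  have "x \<noteq> 0" using uv by (simp add: x_def)
  moreover have "det2 x w = 0" "det2 x w' = 0"
    using assms uv by (auto simp: x_def transporter_in_part_iff split: if_splits)
  ultimately show ?thesis using det2_eq_0_trans by blast
qed

lemma part_nonempty: "w \<noteq> 0 \<Longrightarrow> part w \<noteq> {}"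
  \<comment> \<open>The witness is \<open>transporter (bar w) w\<close>, whose determinant condition
    reads 0 in \<open>Fq\<close>.\<close>
  using transporter_in_part_iff[of "bar w" w w] by auto

lemma partition_on_parts:
  "partition_on {transporter u v | u v. u \<noteq> 0 \<and> v \<noteq> 0} (part ` (UNIV - {0}))"
proof (rule partition_onI)
  show "\<Union> (part ` (UNIV - {0})) = {transporter u v | u v. u \<noteq> 0 \<and> v \<noteq> 0}"
  proof (intro equalityI subsetI)
    fix K :: "('a ^ 2 ^ 2) set" assume "K \<in> {transporter u v | u v. u \<noteq> 0 \<and> v \<noteq> 0}"
    then obtain u v where uv: "K = transporter u v" "u \<noteq> 0" "v \<noteq> 0" by blast
    then have "K \<in> part (if det2 (bar v) u \<in> Fq then v else bar u)"
      by (simp add: transporter_in_part_iff)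
    moreover have "(if det2 (bar v) u \<in> Fq then v else bar u) \<noteq> 0" using uv by simp
    ultimately show "K \<in> \<Union> (part ` (UNIV - {0}))" by blast
  qed (use part_subset in blast)
  show "disjnt B B'" if "B \<in> part ` (UNIV - {0})" "B' \<in> part ` (UNIV - {0})" "B \<noteq> B'" for B B'
    using that parts_meet_imp part_cong unfolding disjnt_iff by blast
qed (use part_nonempty in blast)

section \<open>Counting the parts and their members\<close>

lemma card_parts:
  assumes "finite (UNIV :: 'a set)"
  shows "card (part ` (UNIV - {0})) = CARD('a) + 1"
proof -
  \<comment> \<open>One representative for each point of the projective line.\<close>
  define N :: "('a ^ 2) set" where "N = insert e1 (range (\<lambda>x. vector [x, 1]))"
  have N0: "w \<noteq> 0" if "w \<in> N" for w
    using that by (auto simp: N_def mat2_simps)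
  have "part ` (UNIV - {0}) = part ` N"
  proof
    show "part ` (UNIV - {0}) \<subseteq> part ` N"
    proof
      fix B assume "B \<in> part ` (UNIV - {0})"
      then obtain w where w: "B = part w" "w \<noteq> 0" by blast
      obtain n where "n \<in> N" "det2 w n = 0"
      proof (cases "w $ 2 = 0")
        case True
        then show ?thesis using that[of e1] by (simp add: N_def det2_def)
      next
        case False
        then show ?thesis using that[of "vector [w $ 1 / w $ 2, 1]"] by (simp add: N_def det2_def)
      qed
      then show "B \<in> part ` N" using part_cong w N0 by blast
    qed
  qed (use N0 in blast)
  moreover have "inj_on part N"
  proof (rule inj_onI)
    fix w w' assume *: "w \<in> N" "w' \<in> N" "part w = part w'"
    obtain K where "K \<in> part w"
      using part_nonempty[OF N0[OF *(1)]] by blast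
    then have "det2 w w' = 0"
      using parts_meet_imp[of w w' K] N0 * by simp
    with * show "w = w'" by (auto simp: N_def det2_def)
  qed
  moreover have "card N = CARD('a) + 1"
  proof -
    have "inj (\<lambda>x :: 'a. vector [x, 1] :: 'a ^ 2)"
      by (auto simp: inj_def mat2_simps)
    moreover have "e1 \<notin> range (\<lambda>x :: 'a. vector [x, 1] :: 'a ^ 2)"
      by (auto simp: mat2_simps)
    ultimately show ?thesis using assms by (simp add: N_def card_image)
  qed
  ultimately show ?thesis by (simp add: card_image)
qed

text \<open>The members are indexed by the nonzero vectors through \<open>F\<close>. Two members
  sharing an element have the same index, which gives injectivity and disjointness at once.\<close>

lemma part_e1_card_disjoint:
  "card (part e1) = card (UNIV - {0 :: 'a ^ 2})" "disjoint (part e1)"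
proof -
  define F :: "'a ^ 2 \<Rightarrow> ('a ^ 2 ^ 2) set" where
    "F u = (if u $ 2 \<in> Fq then transporter u e1 else transporter e1 u)" for u
  have e: "e1 \<noteq> (0 :: 'a ^ 2)" by (simp add: mat2_simps)
  have part: "part e1 = F ` (UNIV - {0})"
    unfolding part_def F_def using zero_in_Fq by (auto simp: det2_def)
  have ne: "F u \<noteq> {}" if "u \<noteq> 0" for u
    using that e transporter_nonempty by (auto simp: F_def)
  have *: False if "u $ 2 \<in> Fq" "v $ 2 \<notin> Fq" "x \<in> transporter u e1" "x \<in> transporter e1 v" for u v x
  proof -
    \<comment> \<open>Members of different kinds cannot meet: a common x sends (u,\<open>e1\<close>)
      to (\<open>e1\<close>,v), and preserving the determinant forces
      \<open>v $ 2 = - u $ 2\<close>, although only one of the two coordinates lies in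
      \<open>Fq\<close>.\<close>
    have "det2 (x *v u) (x *v e1) = det2 u e1"
      using det2_mult_vec[of x u e1] that(3) by (simp add: transporter_def)
    moreover have "x *v u = e1" "x *v e1 = v"
      using that by (simp_all add: transporter_def)
    ultimately have "v $ 2 = - u $ 2"
      by (simp add: det2_def)
    then show False using that Fq_uminus_iff by simp
  qed
  have inj: "u = v" if "x \<in> F u" "x \<in> F v" for u v x
  proof (cases "u $ 2 \<in> Fq"; cases "v $ 2 \<in> Fq")
    assume "u $ 2 \<in> Fq" "v $ 2 \<in> Fq"
    with that have "det x = 1" "x *v u = x *v v" by (auto simp: F_def transporter_def)
    then show ?thesis using adj2_cancel(2) by metis
  qed (use that * in \<open>auto simp: F_def\<close>, auto simp: transporter_def)
  have "inj_on F (UNIV - {0})"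
    using ne inj by (intro inj_onI) blast
  then show "card (part e1) = card (UNIV - {0 :: 'a ^ 2})"
    unfolding part by (rule card_image)
  show "disjoint (part e1)"
    unfolding part disjoint_def using inj by blast
qed

text \<open>Each part is the image of \<open>part e1\<close> under an injective theta, so both
  properties carry over.\<close>

lemma part_card_disjoint:
  assumes "w \<noteq> 0"
  shows "card (part w) = card (UNIV - {0 :: 'a ^ 2})" "disjoint (part w)"
proof -
  have "e1 \<noteq> (0 :: 'a ^ 2)" by (simp add: mat2_simps)
  then obtain h where "h \<in> transporter w e1"
    using transporter_nonempty assms by blast
  then have h: "det h = 1" "h *v w = e1" by (auto simp: transporter_def)
  then have part: "part w = (`) (theta q h) ` part e1"
    using theta_part[of h w] by simp
  have "inj ((`) (theta q h))"
    using inj_theta[OF h(1)] by (simp add: inj_on_image inj_image_eq_iff inj_def)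
  then show "card (part w) = card (UNIV - {0 :: 'a ^ 2})"
    unfolding part by (simp add: card_image inj_on_subset part_e1_card_disjoint(1))
  show "disjoint (part w)"
    unfolding part
    by (rule disjoint_image) (use inj_theta[OF h(1)] part_e1_card_disjoint in \<open>auto intro: inj_on_subset\<close>)
qed

end

theorem mainTheorem4:
  fixes q Q :: nat and Fq :: "'a::{field,finite} set"
  assumes "primepow q"
    and "Q = q ^ 2"
    and "CARD('a) = Q"
    and "subfield Fq (ring_of_type_algebra :: 'a ring)"
    and "card Fq = q"
  shows "partition_on (sylow_right_cosets (CHAR('a)) (SL2 :: ('a ^ 2 ^ 2) monoid)) (pi_sq q Fq)
    \<and> card (pi_sq q Fq) = Q + 1
    \<and> (\<forall>B \<in> pi_sq q Fq. card B = Q ^ 2 - 1 \<and> disjoint B)"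
proof -
  obtain r n where q: "Factorial_Ring.prime r" "n > 0" "q = r ^ n"
    using assms(1) by (auto simp: primepow_def)
  have card_eq: "CARD('a) = r ^ (n * 2)"
    using assms q by (simp add: power_mult)
  have prime: "Factorial_Ring.prime CHAR('a)"
    by (simp add: prime_CHAR_semidom finite_imp_CHAR_pos)
  have "CHAR('a) dvd r ^ (n * 2)"
    using CHAR_dvd_CARD[where 'a = 'a] card_eq by simp
  then have char: "CHAR('a) = r"
    using prime q(1) by (metis prime_dvd_power primes_dvd_imp_eq)
  have closed: "0 \<in> Fq" "\<And>x y. x \<in> Fq \<Longrightarrow> y \<in> Fq \<Longrightarrow> x * y \<in> Fq"
    using subringE(2,6)[OF subfieldE(1)[OF assms(4)]] by (auto simp: ring_of_type_algebra_def)
  interpret involutive_power q Fq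
  proof
    \<comment> \<open>Here q is a power of the characteristic, so raising to it is additive.\<close>
    show "(x + y) ^ q = x ^ q + y ^ q" for x y :: 'a
      using freshmans_dream'[OF prime] q char by blast
    \<comment> \<open>Applying the power map twice raises to the power \<open>q ^ 2\<close>, the
      size of the field.\<close>
    show "(x ^ q) ^ q = x" for x :: 'a
      using mult_closed_power_card[of UNIV x] assms by (simp add: power2_eq_square flip: power_mult)
    show "Fq = {x. x ^ q = x}"
      using mult_closed_power_card[of Fq] closed assms primepow_gt_Suc_0[OF assms(1)]
      by (intro subset_fixed_points_eq) auto
  qed
  have "sylow_right_cosets (CHAR('a)) (SL2 :: ('a ^ 2 ^ 2) monoid) =
      {transporter u v | u v. u \<noteq> 0 \<and> v \<noteq> 0}"
    using q by (intro sylow_right_cosets_SL2[where k = "n * 2"]) (auto simp: char card_eq)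
  then show ?thesis
    unfolding pi_sq_eq_parts
    using partition_on_parts card_parts part_card_disjoint assms by (auto simp: card_vec2_nonzero)
qed

end
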